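(* The quadratic pencil eigenvalue problem $$\mathbf{B}^*_\lambda\psi^*\equiv(1+z^2)(\psi^* )''+2(\lambda+1)z(\psi^* )'+\lambda(\lambda+1)\psi^*=0$$ has two (admissible) discrete spectra of real negative eigenvalues $$\lambda_l^+=-l,\quad l=1,2,3,\dots,\qquad\text{and}\qquad\lambda_l^-=-l-1,\quad l=0,1,2,3,\dots,$$ with the finite polynomial eigenfunctions given by $$\psi_l^*(z)=z^l+a_{l-2}z^{l-2}+a_{l-4}z^{l-4}+\cdots=\sum_{k=l,l-2,\dots,0}a_kz^k,\qquad a_l=1,$$ where the expansion coefficients satisfy the finite Kummer-type recursion corresponding to the pencil operator: $$a_{k+2}=-\frac{k(k-1)+2(\lambda_l^\pm+1)k+\lambda_l^\pm(\lambda_l^\pm+1)}{(k+2)(k+1)}\,a_k,\qquad\text{for any }k=l,l-2,\dots,2,$$ $$a_1=-\frac{6}{2(\lambda_l^\pm+1)+\lambda_l^\pm(\lambda_l^\pm+1)}\,a_3\qquad\text{and}\qquad a_0=-\frac{2}{\lambda_l^\pm(\lambda_l^\pm+1)}\,a_2 .$$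
   Context: Here $z\in\mathbb{R}$. An eigenvalue of the pencil is a number $\lambda$ for which $\mathbf{B}^*_\lambda\psi^*=0$ has a nontrivial admissible solution $\psi^*$ (eigenfunction); the admissible eigenfunctions are finite polynomials in $z$. The pencil arises from the Laplace equation $\Delta u=0$ in the plane by setting $u(x,y)=e^{\lambda\tau}\psi^*(z)$ with $z=x/(-y)$, $\tau=-\ln(-y)$, $y<0$, and $\mathrm{Re}\,\lambda<0$. *)

theory Defs
  imports "HOL-Analysis.Analysis" "HOL-Computational_Algebra.Polynomial"
begin

text \<open>The variable \<open>z\<close> is real; the eigenvalue parameter and the functions are complex-valued,
  so that reality of the spectrum is an assertion rather than a convention.\<close>

definition pencil_op :: "complex \<Rightarrow> (real \<Rightarrow> complex) \<Rightarrow> real \<Rightarrow> complex" where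
  "pencil_op lam \<psi> z =
     (let D = (\<lambda>f x. vector_derivative f (at x)) in
      of_real (1 + z^2) * D (D \<psi>) z + 2 * (lam + 1) * of_real z * D \<psi> z + lam * (lam + 1) * \<psi> z)"

text \<open>Admissible functions are finite polynomials. In particular they are smooth, so the (total)
  operator \<open>vector_derivative\<close> is the true derivative on them.\<close>

definition admissible :: "(real \<Rightarrow> complex) \<Rightarrow> bool" where
  "admissible \<psi> \<longleftrightarrow> (\<exists>p :: complex poly. \<forall>z. \<psi> z = poly p (of_real z))"

definition pencil_eigenfunction :: "complex \<Rightarrow> (real \<Rightarrow> complex) \<Rightarrow> bool" where
  "pencil_eigenfunction lam \<psi> \<longleftrightarrow>
     admissible \<psi> \<and> (\<exists>z. \<psi> z \<noteq> 0) \<and> (\<forall>z. pencil_op lam \<psi> z = 0)"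

text \<open>The restriction to \<open>Re lam < 0\<close> is part of the setting \<open>u(x,y) = exp(lam \<tau>) \<psi>(z)\<close>. It excludes
  \<open>lam = 0\<close>, for which the constants are solutions.\<close>

definition pencil_spectrum :: "complex set" where
  "pencil_spectrum = {lam. Re lam < 0 \<and> (\<exists>\<psi>. pencil_eigenfunction lam \<psi>)}"

definition lam_plus :: "nat \<Rightarrow> complex" where
  "lam_plus l = - of_nat l"

definition lam_minus :: "nat \<Rightarrow> complex" where
  "lam_minus l = - of_nat l - 1"

definition step_indices :: "nat \<Rightarrow> nat set" where
  "step_indices l = {k. k \<le> l \<and> (even k \<longleftrightarrow> even l)}"

definition psi_star :: "nat \<Rightarrow> (nat \<Rightarrow> complex) \<Rightarrow> real \<Rightarrow> complex" where
  "psi_star l a z = (\<Sum>k\<in>step_indices l. a k * of_real z ^ k)"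

text \<open>Coefficients outside \<open>l, l-2, \<dots>\<close> are set to zero.\<close>

definition monic_step_coeffs :: "nat \<Rightarrow> (nat \<Rightarrow> complex) \<Rightarrow> bool" where
  "monic_step_coeffs l a \<longleftrightarrow> a l = 1 \<and> (\<forall>k. k \<notin> step_indices l \<longrightarrow> a k = 0)"

text \<open>The formula for \<open>a 1\<close> concerns odd \<open>l \<ge> 3\<close> and that for \<open>a 0\<close> even \<open>l \<ge> 2\<close>. For \<open>l = 1\<close>
  and \<open>l = 0\<close> these are the leading coefficient, and the corresponding quotients have
  denominator zero.\<close>

definition kummer_recursion :: "nat \<Rightarrow> complex \<Rightarrow> (nat \<Rightarrow> complex) \<Rightarrow> bool" where
  "kummer_recursion l lam a \<longleftrightarrow>
     (\<forall>k\<in>step_indices l. 2 \<le> k \<longrightarrow>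
        a (k + 2) = - ((of_nat k * (of_nat k - 1) + 2 * (lam + 1) * of_nat k + lam * (lam + 1))
                       / ((of_nat k + 2) * (of_nat k + 1))) * a k) \<and>
     (odd l \<and> 3 \<le> l \<longrightarrow> a 1 = - (6 / (2 * (lam + 1) + lam * (lam + 1))) * a 3) \<and>
     (even l \<and> 2 \<le> l \<longrightarrow> a 0 = - (2 / (lam * (lam + 1))) * a 2)"

end

theory Submission
  imports Defs
begin

text \<open>
  On a polynomial with coefficients \<open>f\<close> the pencil operator acts coefficientwise: the
  coefficient of \<open>z^k\<close> in the image is
  \<open>(k + 2) (k + 1) f (k + 2) + (k + \<lambda>) (k + \<lambda> + 1) f k\<close>, because
  \<open>k (k - 1) + 2 (\<lambda> + 1) k + \<lambda> (\<lambda> + 1) = (k + \<lambda>) (k + \<lambda> + 1)\<close>. This factorization decides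
  everything. At the top index \<open>n\<close> of a nonzero finite solution the term \<open>f (n + 2)\<close> is zero,
  so \<open>(n + \<lambda>) (n + \<lambda> + 1) = 0\<close>, that is, \<open>\<lambda> = -n\<close> or \<open>\<lambda> = -n - 1\<close>
  (lemma \<open>finite_solution_eq_0\<close>). Applied to differences, this gives a uniqueness principle: a
  finite solution is determined by its values at the zeros of the factor
  (lemma \<open>finite_solutions_eqI\<close>). So every eigenvalue with
  \<open>Re \<lambda> < 0\<close> belongs to one of the two sequences.

  Conversely, let \<open>\<lambda>\<close> be \<open>-l\<close> or \<open>-l - 1\<close>. The factor is zero at \<open>l\<close> and nonzero at
  \<open>l - 2, l - 4, \<dots>\<close>, so the recurrence can be solved downwards from \<open>a l = 1\<close>, in exactly one way
  (lemma \<open>ex1_monic_step_solution\<close>). The Kummer recursion is the same set of equations, solved for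
  \<open>a (k + 2)\<close> when \<open>k \<ge> 2\<close> and for \<open>a k\<close> when \<open>k\<close> is \<open>0\<close> or \<open>1\<close>
  (lemma \<open>kummer_recursion_iff_coeff_recurrence\<close>).

  At \<open>\<lambda> = -l - 1\<close> the zeros of the factor are exactly \<open>l\<close> and \<open>l + 1\<close>. They have different
  parity, so each of the two step polynomials of these degrees has coefficient \<open>1\<close> at its own index
  and \<open>0\<close> at the other, and by the uniqueness principle the two polynomials span the eigenspace
  (lemma \<open>eigenfunction_iff_combination\<close>).
\<close>

section \<open>The coefficient recurrence\<close>

definition coeff_recurrence :: "complex \<Rightarrow> (nat \<Rightarrow> complex) \<Rightarrow> bool" where
  "coeff_recurrence lam f \<longleftrightarrow>
     (\<forall>k. (of_nat k + 2) * (of_nat k + 1) * f (k + 2)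
          + (of_nat k + lam) * (of_nat k + lam + 1) * f k = 0)"

lemma lam_plus_Suc: "lam_plus (Suc l) = lam_minus l"
  by (simp add: lam_plus_def lam_minus_def)

lemma Re_lam_plus [simp]: "Re (lam_plus l) = - real l"
  and Re_lam_minus [simp]: "Re (lam_minus l) = - real l - 1"
  by (simp_all add: lam_plus_def lam_minus_def)

text \<open>The two sequences overlap only with a shift by one; hence an eigenvalue determines its index
  up to a neighbour, which has the other parity.\<close>

lemma shared_eigenvalue_index:
  assumes "lam = lam_plus l \<or> lam = lam_minus l" "lam = lam_plus k \<or> lam = lam_minus k"
  shows "k = l \<or> k = Suc l \<or> l = Suc k"
proof -
  have "Re lam = - real l \<or> Re lam = - real l - 1" "Re lam = - real k \<or> Re lam = - real k - 1"
    using assms by (metis Re_lam_plus Re_lam_minus)+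
  then show ?thesis by linarith
qed

lemma indicial_eq_0_iff:
  "(of_nat k + lam) * (of_nat k + lam + 1) = 0 \<longleftrightarrow> lam = lam_plus k \<or> lam = lam_minus k"
proof -
  have "of_nat k + lam = 0 \<longleftrightarrow> lam = lam_plus k"
    unfolding lam_plus_def by (simp add: eq_neg_iff_add_eq_0 ac_simps)
  moreover have "of_nat k + lam + 1 = 0 \<longleftrightarrow> lam = lam_minus k"
    unfolding lam_minus_def
    by (simp add: eq_diff_eq eq_neg_iff_add_eq_0 ac_simps)
  ultimately show ?thesis by simp
qed

lemma coeff_recurrence_linear:
  assumes "coeff_recurrence lam f" "coeff_recurrence lam g"
  shows "coeff_recurrence lam (\<lambda>k. c * f k + d * g k)"
  unfolding coeff_recurrence_def
proof
  fix k
  let ?u = "(of_nat k + 2) * (of_nat k + 1) :: complex"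
    and ?v = "(of_nat k + lam) * (of_nat k + lam + 1)"
  have "?u * (c * f (k + 2) + d * g (k + 2)) + ?v * (c * f k + d * g k)
      = c * (?u * f (k + 2) + ?v * f k) + d * (?u * g (k + 2) + ?v * g k)"
    by (simp add: algebra_simps)
  also have "\<dots> = 0"
    using assms unfolding coeff_recurrence_def by (metis add_0 mult_zero_right)
  finally show "?u * (c * f (k + 2) + d * g (k + 2)) + ?v * (c * f k + d * g k) = 0" .
qed

text \<open>At the last index where \<open>f\<close> is nonzero the recurrence loses its first term, so the factor
  \<open>(k + \<lambda>) (k + \<lambda> + 1)\<close> is zero there; but at such indices \<open>f\<close> is zero by hypothesis.\<close>

lemma finite_solution_eq_0:
  assumes rec: "coeff_recurrence lam f"
    and fin: "\<And>k. N < k \<Longrightarrow> f k = 0"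
    and zero: "\<And>k. lam = lam_plus k \<or> lam = lam_minus k \<Longrightarrow> f k = 0"
  shows "f k = 0"
proof (rule ccontr)
  assume "f k \<noteq> 0"
  define n where "n = (GREATEST k. f k \<noteq> 0)"
  have bound: "\<And>k. f k \<noteq> 0 \<Longrightarrow> k \<le> N"
    using fin not_le by blast
  have "f n \<noteq> 0"
    unfolding n_def by (rule GreatestI_nat[of _ k N]) (use \<open>f k \<noteq> 0\<close> bound in auto)
  moreover have "f (n + 2) = 0"
  proof (rule ccontr)
    assume "f (n + 2) \<noteq> 0"
    then have "n + 2 \<le> n"
      unfolding n_def using bound by (intro Greatest_le_nat[where b = N]) auto
    then show False by simp
  qed
  moreover have "(of_nat n + 2) * (of_nat n + 1) * f (n + 2)
          + (of_nat n + lam) * (of_nat n + lam + 1) * f n = 0"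
    using rec by (simp add: coeff_recurrence_def)
  ultimately have "(of_nat n + lam) * (of_nat n + lam + 1) = 0"
    by simp
  then have "f n = 0" using zero indicial_eq_0_iff by blast
  with \<open>f n \<noteq> 0\<close> show False by contradiction
qed

lemma finite_solutions_eqI:
  assumes rec: "coeff_recurrence lam f" "coeff_recurrence lam g"
    and fin: "\<And>k. M < k \<Longrightarrow> f k = 0" "\<And>k. N < k \<Longrightarrow> g k = 0"
    and agree: "\<And>k. lam = lam_plus k \<or> lam = lam_minus k \<Longrightarrow> f k = g k"
  shows "f = g"
proof
  fix k
  have "1 * f k + (-1) * g k = 0"
    by (rule finite_solution_eq_0[where N = "max M N", OF coeff_recurrence_linear[OF rec]])
      (use fin agree in auto)
  then show "f k = g k" by simp
qed

section \<open>The pencil operator on polynomials\<close>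

lemma vector_derivative_poly_of_real:
  fixes p :: "complex poly"
  shows "vector_derivative (\<lambda>z. poly p (of_real z)) (at x) = poly (pderiv p) (of_real x)"
  by (intro vector_derivative_at has_vector_derivative_real_field poly_DERIV)

text \<open>The pencil operator in the polynomial ring, where multiplication by \<open>z\<close> is \<open>pCons 0\<close>; in this form
  the simplifier computes its coefficients.\<close>

definition pencil_poly :: "complex \<Rightarrow> complex poly \<Rightarrow> complex poly" where
  "pencil_poly lam p =
     pderiv (pderiv p) + pCons 0 (pCons 0 (pderiv (pderiv p)))
     + smult (2 * (lam + 1)) (pCons 0 (pderiv p)) + smult (lam * (lam + 1)) p"

lemma pencil_op_poly:
  "pencil_op lam (\<lambda>z. poly p (of_real z)) z = poly (pencil_poly lam p) (of_real z)"
  by (simp add: pencil_op_def pencil_poly_def vector_derivative_poly_of_real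
      algebra_simps power2_eq_square)

lemma coeff_pencil_poly:
  "coeff (pencil_poly lam p) k =
     (of_nat k + 2) * (of_nat k + 1) * coeff p (k + 2)
     + (of_nat k + lam) * (of_nat k + lam + 1) * coeff p k"
proof (cases k)
  case 0
  then show ?thesis
    by (simp add: pencil_poly_def coeff_pderiv numeral_2_eq_2 algebra_simps)
next
  case (Suc j)
  then show ?thesis
    by (cases j) (simp_all add: pencil_poly_def coeff_pderiv numeral_2_eq_2 algebra_simps)
qed

text \<open>The real line is infinite, so a complex polynomial is determined by its values there.\<close>

lemma poly_of_real_eq_0_iff:
  fixes p :: "complex poly"
  shows "(\<forall>z::real. poly p (of_real z) = 0) \<longleftrightarrow> p = 0"
proof
  assume "\<forall>z::real. poly p (of_real z) = 0"
  then have "range complex_of_real \<subseteq> {z. poly p z = 0}" by auto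
  moreover have "infinite (range complex_of_real)"
    by (simp add: finite_image_iff inj_of_real infinite_UNIV_char_0)
  ultimately show "p = 0"
    using poly_roots_finite finite_subset by blast
qed simp

lemma pencil_eigenfunction_poly_iff:
  "pencil_eigenfunction lam (\<lambda>z. poly p (of_real z))
     \<longleftrightarrow> p \<noteq> 0 \<and> coeff_recurrence lam (coeff p)"
proof -
  have "(\<forall>z. pencil_op lam (\<lambda>z. poly p (of_real z)) z = 0) \<longleftrightarrow> pencil_poly lam p = 0"
    by (simp add: pencil_op_poly poly_of_real_eq_0_iff)
  also have "\<dots> \<longleftrightarrow> coeff_recurrence lam (coeff p)"
    by (simp only: poly_eq_iff coeff_pencil_poly coeff_recurrence_def coeff_0)
  moreover have "(\<exists>z::real. poly p (of_real z) \<noteq> 0) \<longleftrightarrow> p \<noteq> 0"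
    using poly_of_real_eq_0_iff[of p] by metis
  moreover have "admissible (\<lambda>z. poly p (of_real z))"
    unfolding admissible_def by (intro exI[of _ p]) simp
  ultimately show ?thesis
    unfolding pencil_eigenfunction_def by simp
qed

lemma pencil_eigenfunctionE:
  assumes "pencil_eigenfunction lam \<psi>"
  obtains p where "\<psi> = (\<lambda>z. poly p (of_real z))" "p \<noteq> 0" "coeff_recurrence lam (coeff p)"
proof -
  obtain p where "\<psi> = (\<lambda>z. poly p (of_real z))"
    using assms unfolding pencil_eigenfunction_def admissible_def by blast
  with assms that pencil_eigenfunction_poly_iff show thesis by blast
qed

section \<open>Step polynomials and the Kummer recursion\<close>

lemma finite_step_indices [simp]: "finite (step_indices l)"
  unfolding step_indices_def by simp

definition step_poly :: "nat \<Rightarrow> (nat \<Rightarrow> complex) \<Rightarrow> complex poly" where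
  "step_poly l a = (\<Sum>k\<in>step_indices l. monom (a k) k)"

lemma psi_star_eq_poly: "psi_star l a = (\<lambda>z. poly (step_poly l a) (of_real z))"
  by (simp add: fun_eq_iff psi_star_def step_poly_def poly_sum poly_monom)

lemma coeff_step_poly:
  assumes "monic_step_coeffs l a"
  shows "coeff (step_poly l a) = a"
  using assms by (auto simp: fun_eq_iff step_poly_def coeff_sum monic_step_coeffs_def)

lemma pencil_eigenfunction_psi_star_iff:
  assumes "monic_step_coeffs l a"
  shows "pencil_eigenfunction lam (psi_star l a) \<longleftrightarrow> coeff_recurrence lam a"
proof -
  have "step_poly l a \<noteq> 0"
    using coeff_step_poly[OF assms] assms
    by (metis coeff_0 monic_step_coeffs_def zero_neq_one)
  then show ?thesis
    by (simp add: psi_star_eq_poly pencil_eigenfunction_poly_iff coeff_step_poly[OF assms])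
qed

text \<open>No division by zero occurs in the downward recursion from \<open>l\<close>.\<close>

lemma indicial_neq_0:
  assumes "lam = lam_plus l \<or> lam = lam_minus l" "k + 2 \<le> l"
  shows "(of_nat k + lam) * (of_nat k + lam + 1) \<noteq> 0"
proof
  assume "(of_nat k + lam) * (of_nat k + lam + 1) = 0"
  then have "lam = lam_plus k \<or> lam = lam_minus k"
    by (simp only: indicial_eq_0_iff)
  from shared_eigenvalue_index[OF assms(1) this] assms(2) show False by linarith
qed

lemma linear_relation_solve:
  fixes u v x y :: "'a :: field"
  shows "v \<noteq> 0 \<Longrightarrow> u * x + v * y = 0 \<longleftrightarrow> y = - (u / v) * x"
    and "u \<noteq> 0 \<Longrightarrow> u * x + v * y = 0 \<longleftrightarrow> x = - (v / u) * y"
  by (auto simp: field_simps add_eq_0_iff2)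

text \<open>Each clause of the Kummer recursion is one of the equations of the recurrence solved for one of
  its two unknowns, which is legitimate because the coefficient divided by is nonzero. The
  equations not covered by a clause hold for every monic step sequence: at indices of the wrong
  parity or above \<open>l\<close> both terms are zero, and at \<open>l\<close> itself \<open>a (l + 2) = 0\<close> while \<open>\<lambda>\<close> is a zero
  of the factor.\<close>

lemma kummer_recursion_iff_coeff_recurrence:
  assumes a: "monic_step_coeffs l a" and lam: "lam = lam_plus l \<or> lam = lam_minus l"
  shows "kummer_recursion l lam a \<longleftrightarrow> coeff_recurrence lam a"
proof -
  define R where "R k \<longleftrightarrow> (of_nat k + 2) * (of_nat k + 1) * a (k + 2)
          + (of_nat k + lam) * (of_nat k + lam + 1) * a k = 0" for k
  have outside: "R k" if "k \<notin> step_indices l" for k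
  proof -
    from that have "k + 2 \<notin> step_indices l" by (auto simp: step_indices_def)
    with that a show ?thesis by (simp add: R_def monic_step_coeffs_def)
  qed
  have top: "R l"
  proof -
    have "a (l + 2) = 0" using a by (simp add: step_indices_def monic_step_coeffs_def)
    moreover have "(of_nat l + lam) * (of_nat l + lam + 1) = 0"
      using lam by (simp only: indicial_eq_0_iff)
    ultimately show ?thesis by (simp add: R_def)
  qed
  have upward: "R k \<longleftrightarrow> a (k + 2) = - ((of_nat k * (of_nat k - 1) + 2 * (lam + 1) * of_nat k
        + lam * (lam + 1)) / ((of_nat k + 2) * (of_nat k + 1))) * a k" for k
  proof -
    have "(of_nat k + 2) * (of_nat k + 1) \<noteq> (0 :: complex)"
      using of_nat_neq_0[of "k + 1", where 'a = complex] of_nat_neq_0[of k, where 'a = complex]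
      by (simp add: add.commute)
    moreover have "of_nat k * (of_nat k - 1) + 2 * (lam + 1) * of_nat k + lam * (lam + 1)
        = (of_nat k + lam) * (of_nat k + lam + 1)"
      by (simp add: algebra_simps)
    ultimately show ?thesis
      unfolding R_def by (simp only: linear_relation_solve(2) not_False_eq_True)
  qed
  have one: "R 1 \<longleftrightarrow> a 1 = - (6 / (2 * (lam + 1) + lam * (lam + 1))) * a 3" if "3 \<le> l"
  proof -
    have "(1 + lam) * (1 + lam + 1) \<noteq> 0"
      using indicial_neq_0[OF lam, of 1] that by simp
    moreover have "2 * (lam + 1) + lam * (lam + 1) = (1 + lam) * (1 + lam + 1)"
      by (simp add: algebra_simps)
    moreover have "R 1 \<longleftrightarrow> 6 * a 3 + (1 + lam) * (1 + lam + 1) * a 1 = 0"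
      by (simp add: R_def numeral_3_eq_3)
    ultimately show ?thesis
      by (simp only: linear_relation_solve(1) not_False_eq_True)
  qed
  have zero: "R 0 \<longleftrightarrow> a 0 = - (2 / (lam * (lam + 1))) * a 2" if "2 \<le> l"
  proof -
    have "lam * (lam + 1) \<noteq> 0"
      using indicial_neq_0[OF lam, of 0] that by simp
    moreover have "R 0 \<longleftrightarrow> 2 * a 2 + lam * (lam + 1) * a 0 = 0"
      by (simp add: R_def numeral_2_eq_2)
    ultimately show ?thesis
      by (simp only: linear_relation_solve(1) not_False_eq_True)
  qed
  have "kummer_recursion l lam a \<longleftrightarrow>
      (\<forall>k\<in>step_indices l. 2 \<le> k \<longrightarrow> R k) \<and> (odd l \<and> 3 \<le> l \<longrightarrow> R 1) \<and> (even l \<and> 2 \<le> l \<longrightarrow> R 0)"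
    unfolding kummer_recursion_def upward[symmetric] using one zero by blast
  also have "\<dots> \<longleftrightarrow> (\<forall>k. R k)"
  proof (intro iffI allI)
    fix k
    assume *: "(\<forall>k\<in>step_indices l. 2 \<le> k \<longrightarrow> R k) \<and> (odd l \<and> 3 \<le> l \<longrightarrow> R 1)
      \<and> (even l \<and> 2 \<le> l \<longrightarrow> R 0)"
    show "R k"
    proof (cases "k \<in> step_indices l \<and> k < 2 \<and> k \<noteq> l")
      case True
      then have "k < l" "k < 2" "even k \<longleftrightarrow> even l"
        by (auto simp: step_indices_def)
      then have "k = 0 \<and> even l \<and> 2 \<le> l \<or> k = 1 \<and> odd l \<and> 3 \<le> l"
        by presburger
      with * show ?thesis by metis
    next
      case False
      then consider "k \<notin> step_indices l" | "k \<in> step_indices l" "2 \<le> k" | "k = l"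
        by linarith
      then show ?thesis
        using * outside top by cases simp_all
    qed
  qed simp
  finally show ?thesis by (simp add: R_def coeff_recurrence_def)
qed

text \<open>Solving downwards from \<open>a l = 1\<close> gives \<open>a k\<close> as the product of the quotients \<open>q i\<close> over the
  indices \<open>i = k, k + 2, \<dots>, l - 2\<close>. For uniqueness, two solutions agree at \<open>l\<close> because
  they are monic and at \<open>l \<plusminus> 1\<close> because both are zero there by parity, and no other index can be
  a zero of the factor.\<close>

lemma ex1_monic_step_solution:
  assumes lam: "lam = lam_plus l \<or> lam = lam_minus l"
  shows "\<exists>!a. monic_step_coeffs l a \<and> coeff_recurrence lam a"
proof
  define q :: "nat \<Rightarrow> complex" where
    "q i = - ((of_nat i + 2) * (of_nat i + 1) / ((of_nat i + lam) * (of_nat i + lam + 1)))" for i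
  define I where "I k = {i. k \<le> i \<and> i < l \<and> (even i \<longleftrightarrow> even l)}" for k
  define a where "a k = (if k \<in> step_indices l then prod q (I k) else 0)" for k
  have [simp]: "finite (I k)" for k by (simp add: I_def)
  have "I l = {}" by (auto simp: I_def)
  then have monic: "monic_step_coeffs l a"
    by (simp add: monic_step_coeffs_def a_def step_indices_def)
  have "(of_nat k + 2) * (of_nat k + 1) * a (k + 2)
      + (of_nat k + lam) * (of_nat k + lam + 1) * a k = 0" for k
  proof (cases "k + 2 \<in> step_indices l")
    case True
    then have k: "k + 2 \<le> l" "even k \<longleftrightarrow> even l" "k \<in> step_indices l"
      by (auto simp: step_indices_def)
    have "I k = insert k (I (k + 2))"
    proof -
      have "i = k \<or> k + 2 \<le> i" if "k \<le> i" "even i \<longleftrightarrow> even l" for i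
        using that k(2) by (cases "i = k + 1") auto
      then show ?thesis using k by (auto simp: I_def)
    qed
    then have "a k = q k * a (k + 2)"
      using True k(3) by (simp add: a_def I_def)
    then show ?thesis
      using indicial_neq_0[OF lam k(1)] linear_relation_solve(1) by (simp add: q_def)
  next
    case False
    have "k = l" if "k \<in> step_indices l"
    proof (rule ccontr)
      assume "k \<noteq> l"
      with that False show False
        unfolding step_indices_def by (cases "l = k + 1") auto
    qed
    then have "a k = 0 \<or> (of_nat k + lam) * (of_nat k + lam + 1) = 0"
      using lam unfolding a_def indicial_eq_0_iff by auto
    with False show ?thesis by (auto simp: a_def)
  qed
  then have "coeff_recurrence lam a" by (simp add: coeff_recurrence_def)
  with monic show "monic_step_coeffs l a \<and> coeff_recurrence lam a" ..
  fix b assume b: "monic_step_coeffs l b \<and> coeff_recurrence lam b"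
  show "b = a"
  proof (rule finite_solutions_eqI[where M = l and N = l])
    show "b k = 0" "a k = 0" if "l < k" for k
      using that b monic by (simp_all add: monic_step_coeffs_def step_indices_def)
    fix k assume "lam = lam_plus k \<or> lam = lam_minus k"
    from shared_eigenvalue_index[OF lam this] show "b k = a k"
      using b monic by (auto simp: monic_step_coeffs_def step_indices_def)
  qed (use b \<open>coeff_recurrence lam a\<close> in simp_all)
qed

section \<open>Spectrum and eigenspaces\<close>

text \<open>If \<open>\<lambda>\<close> were of neither form \<open>-k\<close> nor \<open>-k - 1\<close>, the factor would have no zeros and
  every polynomial solution would be zero. The restriction \<open>Re \<lambda> < 0\<close> removes only
  \<open>\<lambda> = 0\<close>.\<close>

lemma pencil_spectrum_eq: "pencil_spectrum = lam_plus ` {1..} \<union> range lam_minus"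
proof (intro equalityI subsetI)
  fix lam assume "lam \<in> pencil_spectrum"
  then obtain \<psi> where neg: "Re lam < 0" and "pencil_eigenfunction lam \<psi>"
    unfolding pencil_spectrum_def by blast
  then obtain p where "p \<noteq> 0" and rec: "coeff_recurrence lam (coeff p)"
    by (elim pencil_eigenfunctionE)
  obtain k where k: "lam = lam_plus k \<or> lam = lam_minus k"
  proof (rule ccontr)
    assume "\<not> thesis"
    with that have "coeff p k = 0" for k
      using finite_solution_eq_0[OF rec coeff_eq_0] by blast
    with \<open>p \<noteq> 0\<close> show False by (simp add: poly_eq_iff)
  qed
  moreover have "1 \<le> k" if "lam = lam_plus k"
    using neg that by simp
  ultimately show "lam \<in> lam_plus ` {1..} \<union> range lam_minus" by auto
next
  fix lam assume "lam \<in> lam_plus ` {1..} \<union> range lam_minus"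
  then obtain l where l: "lam = lam_plus l \<or> lam = lam_minus l" and neg: "Re lam < 0"
    by fastforce
  obtain a where "monic_step_coeffs l a" "coeff_recurrence lam a"
    using ex1_monic_step_solution[OF l] by blast
  then have "pencil_eigenfunction lam (psi_star l a)"
    by (simp add: pencil_eigenfunction_psi_star_iff)
  with neg show "lam \<in> pencil_spectrum"
    unfolding pencil_spectrum_def by blast
qed

text \<open>The two step sequences are dual to evaluation at the indices \<open>l + 1\<close> and \<open>l\<close>. Thus the
  combination with weights \<open>coeff p (Suc l)\<close> and \<open>coeff p l\<close> agrees with a solution \<open>p\<close> at both zeros
  of the factor, and so equals it; and a combination with a nonzero weight is a nonzero polynomial.\<close>

lemma eigenfunction_iff_combination:
  assumes a: "monic_step_coeffs (Suc l) a" "coeff_recurrence (lam_minus l) a"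
    and b: "monic_step_coeffs l b" "coeff_recurrence (lam_minus l) b"
  shows "pencil_eigenfunction (lam_minus l) \<psi> \<longleftrightarrow>
     (\<exists>c d. (c \<noteq> 0 \<or> d \<noteq> 0) \<and> \<psi> = (\<lambda>z. c * psi_star (Suc l) a z + d * psi_star l b z))"
proof -
  define comb where "comb c d = smult c (step_poly (Suc l) a) + smult d (step_poly l b)" for c d
  have comb_fun: "(\<lambda>z. c * psi_star (Suc l) a z + d * psi_star l b z)
      = (\<lambda>z. poly (comb c d) (of_real z))" for c d
    by (simp add: comb_def psi_star_eq_poly)
  have coeff_comb: "coeff (comb c d) = (\<lambda>k. c * a k + d * b k)" for c d
    by (simp add: fun_eq_iff comb_def coeff_step_poly[OF a(1)] coeff_step_poly[OF b(1)])
  have lead: "a (Suc l) = 1" "a l = 0" "b l = 1" "b (Suc l) = 0"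
    using a(1) b(1) by (simp_all add: monic_step_coeffs_def step_indices_def)
  have rec_comb: "coeff_recurrence (lam_minus l) (coeff (comb c d))" for c d
    unfolding coeff_comb by (rule coeff_recurrence_linear[OF a(2) b(2)])
  show ?thesis
  proof
    assume "pencil_eigenfunction (lam_minus l) \<psi>"
    then obtain p where p: "\<psi> = (\<lambda>z. poly p (of_real z))" "p \<noteq> 0"
        and rec: "coeff_recurrence (lam_minus l) (coeff p)"
      by (elim pencil_eigenfunctionE)
    define r where "r = comb (coeff p (Suc l)) (coeff p l)"
    have "coeff p = coeff r"
    proof (rule finite_solutions_eqI)
      show "coeff_recurrence (lam_minus l) (coeff r)"
        unfolding r_def by (rule rec_comb)
      fix k assume "lam_minus l = lam_plus k \<or> lam_minus l = lam_minus k"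
      then have "Re (lam_minus l) = Re (lam_plus k) \<or> Re (lam_minus l) = Re (lam_minus k)"
        by metis
      then have "k = Suc l \<or> k = l" by auto
      then show "coeff p k = coeff r k"
        by (auto simp: r_def coeff_comb lead)
    qed (use rec coeff_eq_0 in auto)
    then have "p = r" by (simp add: poly_eq_iff)
    moreover from this have "coeff p (Suc l) \<noteq> 0 \<or> coeff p l \<noteq> 0"
      using \<open>p \<noteq> 0\<close> by (auto simp: r_def comb_def)
    ultimately show "\<exists>c d. (c \<noteq> 0 \<or> d \<noteq> 0)
        \<and> \<psi> = (\<lambda>z. c * psi_star (Suc l) a z + d * psi_star l b z)"
      unfolding comb_fun p(1) r_def by metis
  next
    assume "\<exists>c d. (c \<noteq> 0 \<or> d \<noteq> 0)
        \<and> \<psi> = (\<lambda>z. c * psi_star (Suc l) a z + d * psi_star l b z)"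
    then obtain c d where cd: "c \<noteq> 0 \<or> d \<noteq> 0" and \<psi>: "\<psi> = (\<lambda>z. poly (comb c d) (of_real z))"
      unfolding comb_fun by blast
    have "coeff (comb c d) (Suc l) = c" "coeff (comb c d) l = d"
      by (simp_all add: coeff_comb lead)
    with cd have "comb c d \<noteq> 0" by auto
    then show "pencil_eigenfunction (lam_minus l) \<psi>"
      unfolding \<psi> by (simp add: pencil_eigenfunction_poly_iff rec_comb)
  qed
qed

text \<open>Both sequences consist of integers, and distinct integers are at distance at least \<open>1\<close>.\<close>

lemma discrete_subset_Ints:
  fixes S :: "'a :: real_normed_algebra_1 set"
  assumes "S \<subseteq> \<int>"
  shows "discrete S"
proof (rule uniform_discrete_imp_discrete, rule uniformI1[of 1])
  fix x y assume "x \<in> S" "y \<in> S" and close: "dist x y < 1"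
  with assms obtain m n where "x = of_int m" "y = of_int n"
    by (meson Ints_cases subsetD)
  moreover from this close have "norm (of_int (m - n) :: 'a) < 1"
    by (simp add: dist_norm)
  then have "m = n" by (simp only: norm_of_int)
  ultimately show "x = y" by simp
qed simp

theorem theorem3p1:
  shows
    "pencil_spectrum = lam_plus ` {1..} \<union> range lam_minus
     \<and> (\<forall>lam\<in>pencil_spectrum. lam \<in> \<real> \<and> Re lam < 0)
     \<and> discrete (lam_plus ` {1..}) \<and> discrete (range lam_minus)
     \<and> (\<forall>l lam. (1 \<le> l \<and> lam = lam_plus l) \<or> lam = lam_minus l \<longrightarrow>
          (\<exists>!a. monic_step_coeffs l a \<and> kummer_recursion l lam a)
          \<and> (\<forall>a. monic_step_coeffs l a \<longrightarrow>
                 (pencil_eigenfunction lam (psi_star l a) \<longleftrightarrow> kummer_recursion l lam a)))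
     \<and> (\<forall>l a b.
          monic_step_coeffs (Suc l) a \<and> kummer_recursion (Suc l) (lam_plus (Suc l)) a \<and>
          monic_step_coeffs l b \<and> kummer_recursion l (lam_minus l) b \<longrightarrow>
            lam_plus (Suc l) = lam_minus l
            \<and> (\<forall>\<psi>. pencil_eigenfunction (lam_minus l) \<psi> \<longleftrightarrow>
                 (\<exists>c d. (c \<noteq> 0 \<or> d \<noteq> 0) \<and>
                    \<psi> = (\<lambda>z. c * psi_star (Suc l) a z + d * psi_star l b z))))"
proof (intro conjI allI impI)
  show "pencil_spectrum = lam_plus ` {1..} \<union> range lam_minus"
    by (rule pencil_spectrum_eq)
  show "\<forall>lam\<in>pencil_spectrum. lam \<in> \<real> \<and> Re lam < 0"
    unfolding pencil_spectrum_eq by (auto simp: lam_plus_def lam_minus_def)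
  show "discrete (lam_plus ` {1..})" "discrete (range lam_minus)"
    by (auto intro!: discrete_subset_Ints simp: lam_plus_def lam_minus_def)
next
  fix l lam assume "1 \<le> l \<and> lam = lam_plus l \<or> lam = lam_minus l"
  then have lam: "lam = lam_plus l \<or> lam = lam_minus l" by blast
  note iff = kummer_recursion_iff_coeff_recurrence[OF _ lam]
  show "\<exists>!a. monic_step_coeffs l a \<and> kummer_recursion l lam a"
    using ex1_monic_step_solution[OF lam] iff by (simp cong: conj_cong)
  show "pencil_eigenfunction lam (psi_star l a) \<longleftrightarrow> kummer_recursion l lam a"
    if "monic_step_coeffs l a" for a
    using that by (simp add: iff pencil_eigenfunction_psi_star_iff)
next
  fix l a b
  assume *: "monic_step_coeffs (Suc l) a \<and> kummer_recursion (Suc l) (lam_plus (Suc l)) a \<and>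
          monic_step_coeffs l b \<and> kummer_recursion l (lam_minus l) b"
  show "lam_plus (Suc l) = lam_minus l" by (rule lam_plus_Suc)
  fix \<psi>
  have "coeff_recurrence (lam_minus l) a"
    using * kummer_recursion_iff_coeff_recurrence[of "Suc l" a] lam_plus_Suc by metis
  moreover have "coeff_recurrence (lam_minus l) b"
    using * kummer_recursion_iff_coeff_recurrence[of l b] by blast
  ultimately show "pencil_eigenfunction (lam_minus l) \<psi> \<longleftrightarrow>
     (\<exists>c d. (c \<noteq> 0 \<or> d \<noteq> 0) \<and> \<psi> = (\<lambda>z. c * psi_star (Suc l) a z + d * psi_star l b z))"
    using * by (intro eigenfunction_iff_combination) auto
qed

end
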